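(* Let $b$ be a finite Blaschke product of degree $d$, let $n\ge 1$, let $t_1,\ldots,t_n$ be distinct points on the unit circle $\mathbb{T}$, and let $m_1,\ldots,m_n$ be positive integers. For a function $f\in\mathcal{S}$ consider the condition $$f(z)=b(z)+o\big((z-t_i)^{m_i}\big)\quad\text{as } z\to t_i \text{ nontangentially},\qquad i=1,\ldots,n. \qquad ( * )$$ (1) If $$\left[\frac{m_1+1}{2}\right]+\cdots+\left[\frac{m_n+1}{2}\right]>d,$$ then every $f\in\mathcal{S}$ satisfying $( * )$ satisfies $f(z)=b(z)$ for all $z\in\mathbb{D}$. (2) Otherwise, i.e., if $$\left[\frac{m_1+1}{2}\right]+\cdots+\left[\frac{m_n+1}{2}\right]\le d,$$ the uniqueness result fails: there exists $f\in\mathcal{S}$ with $f\not\equiv b$ on $\mathbb{D}$ satisfying $( * )$.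
   Context: $\mathbb{D}=\{z\in\mathbb{C}:|z|<1\}$ is the open unit disk and $\mathbb{T}$ is the unit circle. $\mathcal{S}$ denotes the Schur class of functions analytic and bounded by one in modulus on $\mathbb{D}$ (i.e. $|f(z)|\le 1$ for all $z\in\mathbb{D}$). A finite Blaschke product of degree $d$ is a function $b(z)=c\prod_{j=1}^{d}\frac{z-a_j}{1-\overline{a_j}z}$ with $|c|=1$ and $a_1,\ldots,a_d\in\mathbb{D}$ (not necessarily distinct). For real $x$, $[x]$ denotes the largest integer that does not exceed $x$. "$z\to t_i$ nontangentially" means that $z\in\mathbb{D}$ tends to $t_i$ while staying in an arbitrary fixed nontangential approach region (Stolz angle) $\{z\in\mathbb{D}:|z-t_i|<M(1-|z|)\}$, $M>1$; thus $( * )$ means that for each $i$ and each $M>1$, $\frac{f(z)-b(z)}{(z-t_i)^{m_i}}\to 0$ as $z\to t_i$ within this region. *)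

theory Defs
  imports "HOL-Complex_Analysis.Complex_Analysis"
begin

text \<open>
  All functions on the open unit disk are represented by total functions of type
  \<^typ>\<open>complex \<Rightarrow> complex\<close> of which only the values on \<^term>\<open>ball (0::complex) 1\<close> matter.
\<close>

definition schur_class :: "(complex \<Rightarrow> complex) set" where
  "schur_class = {f. f holomorphic_on ball 0 1 \<and> (\<forall>z\<in>ball 0 1. cmod (f z) \<le> 1)}"

definition finite_blaschke_product :: "nat \<Rightarrow> (complex \<Rightarrow> complex) \<Rightarrow> bool" where
  "finite_blaschke_product d b \<longleftrightarrow>
     (\<exists>c a. cmod c = 1 \<and> (\<forall>j\<in>{1..d}. a j \<in> ball 0 1) \<and>
       (\<forall>z\<in>ball 0 1. b z = c * (\<Prod>j=1..d. (z - a j) / (1 - cnj (a j) * z))))"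

definition stolz_region :: "complex \<Rightarrow> real \<Rightarrow> complex set" where
  "stolz_region t M = {z \<in> ball 0 1. cmod (z - t) < M * (1 - cmod z)}"

text \<open>\<open>f(z) = b(z) + o((z - t)\<^sup>m)\<close> as \<open>z\<close> tends to the boundary point \<open>t\<close> nontangentially.\<close>

definition nontangential_contact ::
    "(complex \<Rightarrow> complex) \<Rightarrow> (complex \<Rightarrow> complex) \<Rightarrow> complex \<Rightarrow> nat \<Rightarrow> bool" where
  "nontangential_contact f b t m \<longleftrightarrow>
     (\<forall>M>1. ((\<lambda>z. (f z - b z) / (z - t) ^ m) \<longlongrightarrow> 0) (at t within stolz_region t M))"

end

theory Submission
  imports Defs
begin

text \<open>
  Write \<open>b = c N / D\<close> with \<open>N(z) = \<Prod>\<^sub>j (z - a\<^sub>j)\<close> and \<open>D(z) = \<Prod>\<^sub>j (1 - cnj a\<^sub>j z)\<close>, put \<open>k\<^sub>i = (m\<^sub>i + 1) div 2\<close>, so that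
  \<open>2 k\<^sub>i - 1 \<le> m\<^sub>i \<le> 2 k\<^sub>i\<close>, and \<open>K = \<Sum>\<^sub>i k\<^sub>i\<close>. On the unit circle \<open>D(z) = z\<^sup>d cnj (N(z))\<close>, and likewise for every other such pair
  of products (\<open>recip_prod_on_circle\<close>); this is what turns boundary moduli into rational functions.

  Uniqueness, \<open>K > d\<close>. Since \<open>|b| = 1\<close> on the circle, \<open>|g - b|\<^sup>2 \<le> 2 Re (1 - g cnj b)\<close> there for every \<open>g\<close> bounded by one, so
  a Schur function equals \<open>b\<close> once the nonnegative function \<open>Re (1 - g cnj b)\<close> has weighted mean zero over the circle.
  The weight is \<open>|N|\<^sup>2 / |P|\<^sup>2\<close> with \<open>P(z) = \<Prod>\<^sub>i (z - s t\<^sub>i) ^ k\<^sub>i\<close> and \<open>0 < s < 1\<close>. Its numerator cancels the poles of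
  \<open>1 - g cnj b = (b - g) / b\<close> at the zeros of \<open>b\<close>, and because \<open>K \<ge> d + 1\<close> no pole at \<open>0\<close> appears either: the weighted mean is
  the integral of a function holomorphic in the disc except at the points \<open>s t\<^sub>i\<close> (\<open>weighted_defect_on_circle\<close>). By the
  residue theorem it is a sum of integrals over the circles of radius \<open>(1 - s) / 2\<close> about these points. The integrand
  there is of size \<open>|g - b| / (1 - s) ^ (2 k\<^sub>i)\<close>, so contact of order \<open>2 k\<^sub>i - 1\<close> makes each integral tend to zero as \<open>s \<rightarrow> 1\<close>
  (\<open>weighted_defect_integral_bound\<close>), whereas the weight stays bounded below (\<open>interior_bound_by_weighted_defect\<close>).
  A Schur function need not extend to the circle, so the estimates are made for its dilations \<open>g(z) = f(\<rho> z)\<close>, with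
  \<open>\<rho> \<rightarrow> 1\<close> before \<open>s \<rightarrow> 1\<close> (\<open>schur_eq_blaschke_of_contact\<close>).

  Non-uniqueness, \<open>K \<le> d\<close>. Put \<open>f = b (1 - \<epsilon> h |T|\<^sup>2 / |N|\<^sup>2)\<close> on the circle, with \<open>T(z) = \<Prod>\<^sub>i (z - t\<^sub>i) ^ k\<^sub>i\<close>. The condition
  \<open>K \<le> d\<close> is exactly what makes this the boundary function of a rational function without poles in the closed disc. It
  agrees with \<open>b\<close> to order \<open>2 k\<^sub>i\<close> at \<open>t\<^sub>i\<close>, and one more zero there comes from the factor
  \<open>h(z) = 1 / \<Sum>\<^sub>i 1 / (1 - cnj t\<^sub>i z)\<close>. Since \<open>Re (1 / h) \<ge> 1 / 2\<close> on the closed disc, \<open>Re h\<close> dominates \<open>|h|\<^sup>2\<close>, which keeps \<open>|f| \<le> 1\<close>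
  for small \<open>\<epsilon>\<close> (\<open>schur_contact_not_unique\<close>).
\<close>

section \<open>Products of linear factors and their reflections in the unit circle\<close>

definition zero_prod :: "'i set \<Rightarrow> ('i \<Rightarrow> complex) \<Rightarrow> ('i \<Rightarrow> nat) \<Rightarrow> complex \<Rightarrow> complex" where
  "zero_prod I a k z = (\<Prod>i\<in>I. (z - a i) ^ k i)"

definition recip_prod :: "'i set \<Rightarrow> ('i \<Rightarrow> complex) \<Rightarrow> ('i \<Rightarrow> nat) \<Rightarrow> complex \<Rightarrow> complex" where
  "recip_prod I a k z = (\<Prod>i\<in>I. (1 - cnj (a i) * z) ^ k i)"

definition blaschke :: "complex \<Rightarrow> 'i set \<Rightarrow> ('i \<Rightarrow> complex) \<Rightarrow> ('i \<Rightarrow> nat) \<Rightarrow> complex \<Rightarrow> complex" where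
  "blaschke c J a l z = c * zero_prod J a l z / recip_prod J a l z"

lemma zero_prod_holomorphic [holomorphic_intros]: "zero_prod I a k holomorphic_on S"
  unfolding zero_prod_def by (intro holomorphic_intros)

lemma recip_prod_holomorphic [holomorphic_intros]: "recip_prod I a k holomorphic_on S"
  unfolding recip_prod_def by (intro holomorphic_intros)

text \<open>
  On the circle \<open>z cnj z = 1\<close>, hence \<open>1 - cnj a z = z cnj (z - a)\<close>.
\<close>

lemma recip_prod_on_circle:
  assumes "cmod z = 1"
  shows "recip_prod I a k z = z ^ sum k I * cnj (zero_prod I a k z)"
proof -
  have zz: "z * cnj z = 1" using assms by (simp add: complex_norm_square [symmetric])
  have "1 - cnj (a i) * z = z * cnj (z - a i)" for i
    using zz by (simp add: algebra_simps)
  then show ?thesis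
    by (simp add: recip_prod_def zero_prod_def prod.distrib power_mult_distrib power_sum)
qed

lemma recip_factor_nonzero:
  assumes "cmod a < 1" "cmod z \<le> 1"
  shows "1 - cnj a * z \<noteq> 0"
proof
  assume "1 - cnj a * z = 0"
  then have "cmod (cnj a * z) = 1" by simp
  moreover have "cmod (cnj a * z) \<le> cmod a * 1"
    unfolding norm_mult using assms by (intro mult_mono) auto
  ultimately show False using assms by simp
qed

lemma recip_prod_nonzero:
  assumes "finite I" "\<And>i. i \<in> I \<Longrightarrow> cmod (a i) < 1" "cmod z \<le> 1"
  shows "recip_prod I a k z \<noteq> 0"
  unfolding recip_prod_def using assms recip_factor_nonzero by (auto simp: prod_zero_iff)

lemma zero_prod_eq_0_iff:
  assumes "finite I"
  shows "zero_prod I a k z = 0 \<longleftrightarrow> (\<exists>i\<in>I. z = a i \<and> k i > 0)"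
  unfolding zero_prod_def using assms by (auto simp: prod_zero_iff)

lemma zero_prod_nonzero_on_circle:
  assumes "finite J" "\<And>j. j \<in> J \<Longrightarrow> cmod (a j) < 1" "cmod z = 1"
  shows "zero_prod J a l z \<noteq> 0"
proof -
  have "z \<noteq> a j" if "j \<in> J" for j using assms(2) [OF that] assms(3) by auto
  then show ?thesis using assms(1) by (auto simp: zero_prod_eq_0_iff)
qed

lemma norm_prod_power_le:
  assumes "\<And>i. i \<in> I \<Longrightarrow> cmod (x i) \<le> (c::real)"
  shows "cmod (\<Prod>i\<in>I. x i ^ k i) \<le> c ^ sum k I"
  unfolding power_sum prod_norm [symmetric] norm_power
  using assms by (intro prod_mono) (auto intro: power_mono)

lemma norm_prod_power_ge:
  assumes "\<And>i. i \<in> I \<Longrightarrow> (c::real) \<le> cmod (x i)" "0 \<le> c"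
  shows "c ^ sum k I \<le> cmod (\<Prod>i\<in>I. x i ^ k i)"
  unfolding power_sum prod_norm [symmetric] norm_power
  using assms by (intro prod_mono) (auto intro: power_mono)

lemma zero_prod_le:
  assumes "\<And>i. i \<in> I \<Longrightarrow> cmod (a i) \<le> 1" "cmod z \<le> 1"
  shows "cmod (zero_prod I a k z) \<le> 2 ^ sum k I"
  unfolding zero_prod_def
proof (rule norm_prod_power_le)
  fix i assume "i \<in> I"
  then show "cmod (z - a i) \<le> 2"
    using norm_triangle_ineq4 [of z "a i"] assms by fastforce
qed

lemma recip_prod_le:
  assumes "\<And>i. i \<in> I \<Longrightarrow> cmod (a i) \<le> 1" "cmod z \<le> 1"
  shows "cmod (recip_prod I a k z) \<le> 2 ^ sum k I"
  unfolding recip_prod_def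
proof (rule norm_prod_power_le)
  fix i assume "i \<in> I"
  then have "cmod (cnj (a i) * z) \<le> 1"
    using assms by (simp add: norm_mult mult_le_one)
  then show "cmod (1 - cnj (a i) * z) \<le> 2"
    using norm_triangle_ineq4 [of 1 "cnj (a i) * z"] by simp
qed

text \<open>
  The difference of the squared moduli factors as \<open>(1 - |a|\<^sup>2) (1 - |z|\<^sup>2)\<close>; in other words, the pseudo-hyperbolic
  distance of two points of the disc is at most one.
\<close>

lemma recip_factor_ge:
  assumes "cmod a \<le> 1" "cmod z \<le> 1"
  shows "cmod (z - a) \<le> cmod (1 - cnj a * z)"
proof -
  have "(cmod (1 - cnj a * z))\<^sup>2 - (cmod (z - a))\<^sup>2 = (1 - (cmod a)\<^sup>2) * (1 - (cmod z)\<^sup>2)"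
    unfolding cmod_power2 by simp algebra
  also have "\<dots> \<ge> 0"
    using assms by (intro mult_nonneg_nonneg) (simp_all add: power_le_one)
  finally have "(cmod (z - a))\<^sup>2 \<le> (cmod (1 - cnj a * z))\<^sup>2" by simp
  then show ?thesis by (rule power2_le_imp_le) simp
qed

lemma zero_prod_bounded_below_on_circle:
  assumes "finite J" "\<And>j. j \<in> J \<Longrightarrow> cmod (a j) < 1"
  obtains \<delta> where "\<delta> > 0" "\<And>z. cmod z = 1 \<Longrightarrow> \<delta> \<le> (cmod (zero_prod J a l z))\<^sup>2"
proof -
  have cont: "continuous_on (sphere 0 1) (\<lambda>z. (cmod (zero_prod J a l z))\<^sup>2)"
    by (intro continuous_intros holomorphic_on_imp_continuous_on [OF zero_prod_holomorphic])
  have "\<exists>x\<in>sphere 0 1. \<forall>y\<in>sphere 0 1.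
      (cmod (zero_prod J a l x))\<^sup>2 \<le> (cmod (zero_prod J a l y))\<^sup>2"
    by (rule continuous_attains_inf [OF compact_sphere _ cont]) (auto intro!: exI [of _ 1])
  then obtain x where x: "cmod x = 1"
    "\<And>y. cmod y = 1 \<Longrightarrow> (cmod (zero_prod J a l x))\<^sup>2 \<le> (cmod (zero_prod J a l y))\<^sup>2"
    by auto
  show ?thesis
    using x zero_prod_nonzero_on_circle [OF assms x(1)]
    by (intro that [of "(cmod (zero_prod J a l x))\<^sup>2"]) auto
qed

lemma blaschke_unimodular_on_circle:
  assumes "finite J" "\<And>j. j \<in> J \<Longrightarrow> cmod (a j) < 1" "cmod c = 1" "cmod z = 1"
  shows "cmod (blaschke c J a l z) = 1"
  using zero_prod_nonzero_on_circle [OF assms(1,2,4)] assms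
  by (simp add: blaschke_def norm_mult norm_divide recip_prod_on_circle norm_power)

section \<open>The weighted boundary defect\<close>

text \<open>
  The factor \<open>N - cnj c g D\<close> is \<open>cnj c D (b - g)\<close>, written without division. The power of \<open>z\<close> has a nonnegative
  exponent precisely when the degree of the weight's denominator exceeds that of the Blaschke product; the truncated
  subtraction is only meaningful in that case.
\<close>

definition weighted_defect ::
    "complex \<Rightarrow> 'j set \<Rightarrow> ('j \<Rightarrow> complex) \<Rightarrow> ('j \<Rightarrow> nat) \<Rightarrow> 'i set \<Rightarrow> ('i \<Rightarrow> complex) \<Rightarrow> ('i \<Rightarrow> nat)
      \<Rightarrow> (complex \<Rightarrow> complex) \<Rightarrow> complex \<Rightarrow> complex" where
  "weighted_defect c J a l I p k g z =
     z ^ (sum k I - sum l J - 1) * recip_prod J a l z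
       * (zero_prod J a l z - cnj c * g z * recip_prod J a l z)
       / (zero_prod I p k z * recip_prod I p k z)"

text \<open>
  Along the circle \<open>dz = \<i> z d\<theta>\<close>, so \<open>z\<close> times the integrand is the density with respect to the angle.
  Its real part is nonnegative whenever \<open>|g| \<le> 1\<close>.
\<close>

lemma weighted_defect_on_circle:
  assumes fin: "finite I" "finite J"
    and a: "\<And>j. j \<in> J \<Longrightarrow> cmod (a j) < 1" and p: "\<And>i. i \<in> I \<Longrightarrow> cmod (p i) < 1"
    and deg: "sum l J < sum k I" and z: "cmod z = 1"
  shows "z * weighted_defect c J a l I p k g z =
     of_real ((cmod (zero_prod J a l z) / cmod (zero_prod I p k z))\<^sup>2) * (1 - g z * cnj (blaschke c J a l z))"
proof -
  define N where "N = zero_prod J a l z"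
  define P where "P = zero_prod I p k z"
  define d where "d = sum l J"
  define K where "K = sum k I"
  have nz: "N \<noteq> 0" "P \<noteq> 0" "z \<noteq> 0"
    using zero_prod_nonzero_on_circle [OF fin(2) a z] zero_prod_nonzero_on_circle [OF fin(1) p z] z
    by (auto simp: N_def P_def)
  have D: "recip_prod J a l z = z ^ d * cnj N" and Q: "recip_prod I p k z = z ^ K * cnj P"
    using recip_prod_on_circle [OF z] by (simp_all add: N_def P_def d_def K_def)
  have cz: "cnj z = inverse z"
    using z complex_norm_square [of z] nz by (simp add: field_simps)
  \<comment> \<open>The powers of \<open>z\<close> coming from the two reflected products cancel against the explicit power.\<close>
  have pw: "z * z ^ (K - d - 1) * z ^ d = z ^ K"
    using deg by (simp add: d_def K_def power_add [symmetric] flip: power_Suc)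
  have "z * weighted_defect c J a l I p k g z =
      (z * z ^ (K - d - 1) * z ^ d) * cnj N * (N - cnj c * g z * (z ^ d * cnj N)) / (P * (z ^ K * cnj P))"
    unfolding weighted_defect_def D Q by (simp add: N_def P_def K_def d_def mult_ac)
  also have "\<dots> = cnj N * (N - cnj c * g z * (z ^ d * cnj N)) / (P * cnj P)"
    unfolding pw using nz by (simp add: field_simps)
  also have "\<dots> = (N * cnj N) / (P * cnj P) * (1 - g z * cnj (blaschke c J a l z))"
    using nz by (simp add: blaschke_def D N_def [symmetric] cz field_simps power_inverse)
  also have "(N * cnj N) / (P * cnj P) = of_real ((cmod N / cmod P)\<^sup>2)"
    unfolding power_divide of_real_divide complex_norm_square ..
  finally show ?thesis by (simp add: N_def P_def)
qed

lemma norm_diff_sq_le_defect: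
  assumes "cmod u \<le> 1" "cmod v = 1"
  shows "(cmod (u - v))\<^sup>2 \<le> 2 * Re (1 - u * cnj v)"
proof -
  have "(cmod (u - v))\<^sup>2 = (cmod u)\<^sup>2 + (cmod v)\<^sup>2 - 2 * Re (u * cnj v)"
    unfolding cmod_power2 by (simp add: power2_eq_square algebra_simps)
  moreover have "(cmod u)\<^sup>2 \<le> 1" using assms by (simp add: power_le_one)
  ultimately show ?thesis using assms by simp
qed

text \<open>
  Compares two circle integrals when only the real part of the second angular density is known to be nonnegative:
  the mean of that real part is at most the modulus of the whole integral, divided by \<open>2 \<pi>\<close>.
\<close>

lemma circle_integral_majorant:
  assumes F: "(F has_contour_integral x) (circlepath 0 1)"
    and G: "(G has_contour_integral y) (circlepath 0 1)"
    and le: "\<And>z. cmod z = 1 \<Longrightarrow> cmod (F z) \<le> C * Re (z * G z)"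
    and C: "C \<ge> 0"
  shows "cmod x \<le> C * cmod y"
proof -
  define e where "e = (\<lambda>u::real. exp (2 * of_real pi * \<i> * of_real u))"
  have e1: "cmod (e u) = 1" for u by (simp add: e_def)
  have cp: "circlepath 0 1 u = e u" for u by (simp add: circlepath e_def)
  have vd: "vector_derivative (circlepath 0 1) (at u) = 2 * pi * \<i> * e u" for u
    by (simp add: vector_derivative_circlepath e_def)
  have F': "((\<lambda>u. F (e u) * (2 * pi * \<i> * e u)) has_integral x) {0..1}"
    using F unfolding has_contour_integral cp vd .
  have G': "((\<lambda>u. G (e u) * (2 * pi * \<i> * e u)) has_integral y) {0..1}"
    using G unfolding has_contour_integral cp vd .
  have "((\<lambda>u. Im (G (e u) * (2 * pi * \<i> * e u))) has_integral Im y) {0..1}"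
    using has_integral_linear [OF G' bounded_linear_Im] by (simp add: o_def)
  from has_integral_mult_right [OF this, of C]
  have G'': "((\<lambda>u. C * (2 * pi * Re (e u * G (e u)))) has_integral C * Im y) {0..1}"
    by (simp add: algebra_simps)
  have "cmod (integral {0..1} (\<lambda>u. F (e u) * (2 * pi * \<i> * e u)))
      \<le> integral {0..1} (\<lambda>u. C * (2 * pi * Re (e u * G (e u))))"
  proof (rule Henstock_Kurzweil_Integration.integral_norm_bound_integral)
    fix u :: real
    have "cmod (F (e u)) * (2 * pi) \<le> C * Re (e u * G (e u)) * (2 * pi)"
      using le [OF e1] by (intro mult_right_mono) auto
    then show "cmod (F (e u) * (2 * pi * \<i> * e u)) \<le> C * (2 * pi * Re (e u * G (e u)))"
      by (simp add: norm_mult e1 mult_ac)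
  qed (use F' G'' in auto)
  then have "cmod x \<le> C * Im y"
    unfolding integral_unique [OF F'] integral_unique [OF G''] .
  also have "\<dots> \<le> C * cmod y"
    using C abs_Im_le_cmod [of y] by (intro mult_left_mono) auto
  finally show ?thesis .
qed

text \<open>
  Cauchy's formula is applied to \<open>(g - b)\<^sup>2\<close>, because its modulus on the circle is what \<open>norm_diff_sq_le_defect\<close>
  controls. The bound depends on the poles \<open>p\<close> only through the integral, as \<open>|P|\<^sup>2 \<le> 4\<^sup>K\<close> wherever the poles lie in the
  disc.
\<close>

lemma interior_bound_by_weighted_defect:
  assumes fin: "finite I" "finite J"
    and a: "\<And>j. j \<in> J \<Longrightarrow> cmod (a j) < 1" and p: "\<And>i. i \<in> I \<Longrightarrow> cmod (p i) < 1"
    and c: "cmod c = 1" and deg: "sum l J < sum k I"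
    and \<delta>: "\<delta> > 0" "\<And>z. cmod z = 1 \<Longrightarrow> \<delta> \<le> (cmod (zero_prod J a l z))\<^sup>2"
    and g: "g holomorphic_on ball 0 r" "r > 1" "\<And>z. cmod z = 1 \<Longrightarrow> cmod (g z) \<le> 1"
    and w: "cmod w < 1"
  shows "(cmod (g w - blaschke c J a l w))\<^sup>2
     \<le> 4 ^ sum k I / (\<delta> * (1 - cmod w)) * cmod (contour_integral (circlepath 0 1) (weighted_defect c J a l I p k g))"
proof -
  define B where "B = blaschke c J a l"
  define H where "H = weighted_defect c J a l I p k g"
  have sub: "cball 0 1 \<subseteq> ball (0::complex) r" using g(2) by auto
  have holo: "g holomorphic_on cball 0 1" using g(1) sub by (rule holomorphic_on_subset)
  have Bholo: "B holomorphic_on cball 0 1"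
    unfolding B_def blaschke_def using recip_prod_nonzero [OF fin(2) a]
    by (intro holomorphic_intros) auto
  have sq: "(\<lambda>z. (g z - B z)\<^sup>2) holomorphic_on cball 0 1"
    using holo Bholo by (intro holomorphic_intros)
  have F: "((\<lambda>z. (g z - B z)\<^sup>2 / (z - w)) has_contour_integral 2 * of_real pi * \<i> * (g w - B w)\<^sup>2)
      (circlepath 0 1)"
    using w by (intro Cauchy_integral_circlepath holomorphic_on_imp_continuous_on [OF sq]
        holomorphic_on_subset [OF sq]) auto
  have nz: "zero_prod I p k z * recip_prod I p k z \<noteq> 0" if "cmod z = 1" for z
    using zero_prod_nonzero_on_circle [OF fin(1) p that] recip_prod_nonzero [OF fin(1) p] that by auto
  have "continuous_on (sphere 0 1) H"
    unfolding H_def weighted_defect_def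
    by (intro continuous_intros holomorphic_on_imp_continuous_on [OF zero_prod_holomorphic]
        holomorphic_on_imp_continuous_on [OF recip_prod_holomorphic]
        holomorphic_on_imp_continuous_on [OF holomorphic_on_subset [OF holo]])
      (use nz in auto)
  then have G: "(H has_contour_integral contour_integral (circlepath 0 1) H) (circlepath 0 1)"
    by (intro has_contour_integral_integral contour_integrable_continuous_circlepath) auto
  define C where "C = 2 * 4 ^ sum k I / (\<delta> * (1 - cmod w))"
  have "cmod (2 * of_real pi * \<i> * (g w - B w)\<^sup>2) \<le> C * cmod (contour_integral (circlepath 0 1) H)"
  proof (rule circle_integral_majorant [OF F G])
    show "C \<ge> 0" using \<delta> w by (simp add: C_def)
    fix z :: complex assume z: "cmod z = 1"
    define q where "q = (cmod (zero_prod J a l z) / cmod (zero_prod I p k z))\<^sup>2"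
    define R where "R = Re (1 - g z * cnj (B z))"
    have zH: "Re (z * H z) = q * R"
      unfolding H_def using weighted_defect_on_circle [OF fin a p deg z]
      by (simp add: q_def R_def B_def flip: of_real_power)
    have sqR: "(cmod (g z - B z))\<^sup>2 \<le> 2 * R"
      unfolding R_def B_def using norm_diff_sq_le_defect g(3) blaschke_unimodular_on_circle fin a c z
      by blast
    then have R0: "R \<ge> 0" using zero_le_power2 [of "cmod (g z - B z)"] by linarith
    have P0: "cmod (zero_prod I p k z) > 0" using nz [OF z] by auto
    have "(cmod (zero_prod I p k z))\<^sup>2 \<le> (2 ^ sum k I)\<^sup>2"
      using zero_prod_le [of I p z k] p z by (intro power_mono) (auto simp: less_imp_le)
    also have "\<dots> = 4 ^ sum k I" by (simp add: power_even_eq [symmetric] power_mult)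
    finally have P4: "(cmod (zero_prod I p k z))\<^sup>2 \<le> 4 ^ sum k I" .
    \<comment> \<open>The weight \<open>q\<close> is bounded below, so the unweighted defect is at most a multiple of the weighted one.\<close>
    have "\<delta> / 4 ^ sum k I \<le> q"
      unfolding q_def power_divide using \<delta> z P4 P0 by (intro frac_le) auto
    then have "1 \<le> 4 ^ sum k I / \<delta> * q" using \<delta> by (simp add: field_simps)
    then have "2 * R \<le> 2 * R * (4 ^ sum k I / \<delta> * q)"
      using R0 mult_left_mono [of 1 "4 ^ sum k I / \<delta> * q" "2 * R"] by simp
    also have "\<dots> = 2 * 4 ^ sum k I / \<delta> * Re (z * H z)"
      unfolding zH by simp
    finally have sqH: "(cmod (g z - B z))\<^sup>2 \<le> 2 * 4 ^ sum k I / \<delta> * Re (z * H z)"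
      using sqR by linarith
    have zw: "1 - cmod w \<le> cmod (z - w)" using norm_triangle_ineq2 [of z w] z by simp
    have "cmod ((g z - B z)\<^sup>2 / (z - w)) = (cmod (g z - B z))\<^sup>2 / cmod (z - w)"
      by (simp add: norm_divide norm_power)
    also have "\<dots> \<le> (2 * 4 ^ sum k I / \<delta> * Re (z * H z)) / (1 - cmod w)"
      using sqH zw w by (intro frac_le) (auto intro: order_trans [OF zero_le_power2])
    also have "\<dots> = C * Re (z * H z)" by (simp add: C_def)
    finally show "cmod ((g z - B z)\<^sup>2 / (z - w)) \<le> C * Re (z * H z)" .
  qed
  then have "2 * (cmod (g w - B w))\<^sup>2 * pi \<le> C * cmod (contour_integral (circlepath 0 1) H)"
    by (simp add: norm_mult norm_power mult_ac)
  moreover have "2 * (cmod (g w - B w))\<^sup>2 * 1 \<le> 2 * (cmod (g w - B w))\<^sup>2 * pi"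
    using pi_gt3 by (intro mult_left_mono) auto
  ultimately have "2 * (cmod (g w - B w))\<^sup>2 \<le> C * cmod (contour_integral (circlepath 0 1) H)" by linarith
  then show ?thesis by (simp add: C_def B_def H_def)
qed

section \<open>Residues of the weighted defect near the contact points\<close>

lemma open_superset_disc_contains_ball:
  assumes "open S" "cball (0::complex) 1 \<subseteq> S"
  obtains r where "r > 1" "ball 0 r \<subseteq> S"
proof -
  obtain e where e: "e > 0" "(\<Union>x\<in>cball (0::complex) 1. ball x e) \<subseteq> S"
    using compact_subset_open_imp_ball_epsilon_subset [OF compact_cball assms] by blast
  have "ball 0 (1 + e) \<subseteq> (\<Union>x\<in>cball (0::complex) 1. ball x e)"
  proof
    fix z :: complex assume z: "z \<in> ball 0 (1 + e)"
    show "z \<in> (\<Union>x\<in>cball 0 1. ball x e)"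
    proof (cases "cmod z \<le> 1")
      case True
      then show ?thesis using e(1) by (intro UN_I [of z]) auto
    next
      case False
      then have z0: "z \<noteq> 0" by auto
      have "dist (z / cmod z) z = cmod (z * (1 - 1 / cmod z))"
        using False by (simp add: dist_norm norm_minus_commute algebra_simps)
      also have "\<dots> = cmod z * \<bar>1 - 1 / cmod z\<bar>"
        by (metis (no_types) norm_mult norm_of_real of_real_1 of_real_diff of_real_divide)
      also have "\<bar>1 - 1 / cmod z\<bar> = 1 - 1 / cmod z"
        using False by (intro abs_of_nonneg) (simp add: divide_le_eq_1)
      also have "cmod z * (1 - 1 / cmod z) = cmod z - 1" using z0 by (simp add: field_simps)
      finally show ?thesis using z False
        by (intro UN_I [of "z / cmod z"]) (auto simp: norm_divide)
    qed
  qed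
  with e show ?thesis by (intro that [of "1 + e"]) auto
qed

text \<open>
  With \<open>s = 1 - 2 \<epsilon>\<close>, a pole \<open>s t\<^sub>i\<close> lies at distance \<open>2 \<epsilon>\<close> from the unit circle. On the circle of radius \<open>\<epsilon>\<close> about it
  the factors of the denominator belonging to \<open>i\<close> contribute at least \<open>\<epsilon> ^ (2 k\<^sub>i)\<close>, and all others are bounded below by
  the separation \<open>\<sigma>\<close> of the points \<open>t\<^sub>j\<close>.
\<close>

lemma weighted_defect_small_circle_bound:
  assumes fin: "finite I" "finite J" and i: "i \<in> I"
    and a: "\<And>j. j \<in> J \<Longrightarrow> cmod (a j) < 1" and t: "\<And>i. i \<in> I \<Longrightarrow> cmod (t i) = 1"
    and k: "k i > 0" and c: "cmod c = 1"
    and sep: "0 < \<sigma>" "\<sigma> \<le> 1" "\<And>i j. i \<in> I \<Longrightarrow> j \<in> I \<Longrightarrow> i \<noteq> j \<Longrightarrow> \<sigma> \<le> cmod (t i - t j)"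
    and \<epsilon>: "0 < \<epsilon>" "\<epsilon> \<le> \<sigma> / 6"
    and p: "p = (\<lambda>i. of_real (1 - 2 * \<epsilon>) * t i)"
    and z: "cmod (z - p i) = \<epsilon>"
    and gB: "cmod (g z - blaschke c J a l z) \<le> \<eta> * \<epsilon> ^ (2 * k i - 1)"
  shows "cmod (weighted_defect c J a l I p k g z) \<le> 4 ^ sum l J / (\<sigma> / 2) ^ (2 * sum k I) * \<eta> / \<epsilon>"
proof -
  define N where "N = zero_prod J a l z"
  define D where "D = recip_prod J a l z"
  define P where "P = zero_prod I p k z"
  define Q where "Q = recip_prod I p k z"
  have np: "cmod (p j) = 1 - 2 * \<epsilon>" if "j \<in> I" for j
    unfolding p norm_mult t [OF that] norm_of_real using \<epsilon> sep by simp
  have z1: "cmod z \<le> 1"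
    using norm_triangle_ineq [of "z - p i" "p i"] z np [OF i] \<epsilon> by simp
  have far: "\<sigma> / 2 \<le> cmod (z - p j)" if "j \<in> I" "j \<noteq> i" for j
  proof -
    have "p i - p j = of_real (1 - 2 * \<epsilon>) * (t i - t j)" by (simp add: p algebra_simps)
    then have "cmod (p i - p j) = (1 - 2 * \<epsilon>) * cmod (t i - t j)"
      using \<epsilon> sep by (simp only: norm_mult norm_of_real)
    also have "\<dots> \<ge> (1 - 2 * \<epsilon>) * \<sigma>"
      using \<epsilon> sep that i by (intro mult_left_mono) auto
    finally have 1: "cmod (p i - p j) \<ge> (1 - 2 * \<epsilon>) * \<sigma>" .
    have "\<epsilon> * \<sigma> \<le> \<epsilon>" using \<epsilon> sep by (simp add: mult_left_le)
    with 1 have "cmod (p i - p j) \<ge> \<sigma> - 2 * \<epsilon>" by (simp only: left_diff_distrib)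
    moreover have "cmod (p i - p j) \<le> \<epsilon> + cmod (z - p j)"
      using norm_triangle_ineq [of "p i - z" "z - p j"] z by (simp add: norm_minus_commute)
    ultimately show ?thesis using \<epsilon> by linarith
  qed
  have "\<epsilon> ^ k i * (\<sigma> / 2) ^ sum k I \<le> \<epsilon> ^ k i * (\<sigma> / 2) ^ sum k (I - {i})"
    using \<epsilon> sep fin i by (intro mult_left_mono power_decreasing sum_mono2) auto
  also have "\<dots> \<le> \<epsilon> ^ k i * cmod (\<Prod>j\<in>I - {i}. (z - p j) ^ k j)"
    using \<epsilon> sep far by (intro mult_left_mono norm_prod_power_ge) auto
  also have "\<dots> = cmod P"
    unfolding P_def zero_prod_def
    by (simp add: prod.remove [OF fin(1) i] norm_mult norm_power z)
  finally have Pge: "\<epsilon> ^ k i * (\<sigma> / 2) ^ sum k I \<le> cmod P" .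
  \<comment> \<open>The reflected product is the larger one, so a lower bound for \<open>P\<close> serves for both.\<close>
  have QP: "cmod P \<le> cmod Q"
    unfolding P_def Q_def zero_prod_def recip_prod_def prod_norm [symmetric] norm_power
  proof (intro prod_mono conjI power_mono)
    fix j assume "j \<in> I"
    then show "cmod (z - p j) \<le> cmod (1 - cnj (p j) * z)"
      using np z1 \<epsilon> by (intro recip_factor_ge) auto
  qed auto
  have pos: "0 < \<epsilon> ^ k i * (\<sigma> / 2) ^ sum k I" using \<epsilon> sep by simp
  have den: "\<epsilon> ^ (2 * k i) * (\<sigma> / 2) ^ (2 * sum k I) \<le> cmod P * cmod Q"
  proof -
    have "\<epsilon> ^ (2 * k i) * (\<sigma> / 2) ^ (2 * sum k I) =
        (\<epsilon> ^ k i * (\<sigma> / 2) ^ sum k I) * (\<epsilon> ^ k i * (\<sigma> / 2) ^ sum k I)"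
      by (simp add: mult_2 power_add)
    also have "\<dots> \<le> cmod P * cmod Q"
      using Pge QP pos by (intro mult_mono) auto
    finally show ?thesis .
  qed
  have D0: "D \<noteq> 0" unfolding D_def using recip_prod_nonzero [OF fin(2) a z1] .
  have D2: "cmod D \<le> 2 ^ sum l J"
    unfolding D_def using a z1 by (intro recip_prod_le) (auto simp: less_imp_le)
  \<comment> \<open>\<open>cnj c\<close> inverts \<open>c\<close>, so the numerator is a bounded multiple of \<open>b - g\<close>.\<close>
  have cc: "cnj c * c = 1" using c by (simp add: mult.commute flip: complex_norm_square)
  have "N - cnj c * g z * D = cnj c * D * (blaschke c J a l z - g z)"
    using D0 cc by (simp add: blaschke_def N_def D_def field_simps)
  then have "cmod (N - cnj c * g z * D) = cmod D * cmod (g z - blaschke c J a l z)"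
    by (simp add: norm_mult c norm_minus_commute)
  also have "\<dots> \<le> 2 ^ sum l J * (\<eta> * \<epsilon> ^ (2 * k i - 1))"
    using D2 gB by (intro mult_mono) auto
  finally have num1: "cmod (N - cnj c * g z * D) \<le> 2 ^ sum l J * (\<eta> * \<epsilon> ^ (2 * k i - 1))" .
  have num: "cmod (z ^ (sum k I - sum l J - 1) * D * (N - cnj c * g z * D))
      \<le> 1 * 2 ^ sum l J * (2 ^ sum l J * (\<eta> * \<epsilon> ^ (2 * k i - 1)))"
    unfolding norm_mult [of _ "N - cnj c * g z * D"] norm_mult [of _ D] norm_power
    using z1 D2 num1 by (intro mult_mono power_le_one) auto
  have nn: "0 \<le> \<eta> * \<epsilon> ^ (2 * k i - 1)" using gB norm_ge_zero order_trans by blast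
  have "cmod (weighted_defect c J a l I p k g z)
      = cmod (z ^ (sum k I - sum l J - 1) * D * (N - cnj c * g z * D)) / (cmod P * cmod Q)"
    by (simp add: weighted_defect_def N_def D_def P_def Q_def norm_mult norm_divide)
  also have "\<dots> \<le> (1 * 2 ^ sum l J * (2 ^ sum l J * (\<eta> * \<epsilon> ^ (2 * k i - 1))))
       / (\<epsilon> ^ (2 * k i) * (\<sigma> / 2) ^ (2 * sum k I))"
    using num den nn \<epsilon> sep by (intro frac_le) auto
  also have "\<epsilon> ^ (2 * k i) = \<epsilon> * \<epsilon> ^ (2 * k i - 1)"
    using k by (simp flip: power_Suc)
  also have "(1 * 2 ^ sum l J * (2 ^ sum l J * (\<eta> * \<epsilon> ^ (2 * k i - 1))))
       / (\<epsilon> * \<epsilon> ^ (2 * k i - 1) * (\<sigma> / 2) ^ (2 * sum k I))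
      = (2 ^ sum l J * 2 ^ sum l J) / (\<sigma> / 2) ^ (2 * sum k I) * \<eta> / \<epsilon>"
    using \<epsilon> sep by (simp add: field_simps)
  also have "2 ^ sum l J * 2 ^ sum l J = (4 :: real) ^ sum l J"
    by (simp flip: power_mult_distrib)
  finally show ?thesis .
qed

text \<open>
  The only singularities in the closed disc are the poles \<open>p\<^sub>i\<close>, so the integral over the unit circle is the sum of the
  integrals over the small circles. Each of these has length \<open>2 \<pi> \<epsilon>\<close> and an integrand of size \<open>\<eta> / \<epsilon>\<close>, which is why the
  bound does not depend on \<open>\<epsilon>\<close>.
\<close>

lemma weighted_defect_integral_bound:
  assumes fin: "finite I" "finite J"
    and a: "\<And>j. j \<in> J \<Longrightarrow> cmod (a j) < 1" and t: "\<And>i. i \<in> I \<Longrightarrow> cmod (t i) = 1"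
    and k: "\<And>i. i \<in> I \<Longrightarrow> k i > 0" and c: "cmod c = 1"
    and sep: "0 < \<sigma>" "\<sigma> \<le> 1" "\<And>i j. i \<in> I \<Longrightarrow> j \<in> I \<Longrightarrow> i \<noteq> j \<Longrightarrow> \<sigma> \<le> cmod (t i - t j)"
    and \<epsilon>: "0 < \<epsilon>" "\<epsilon> \<le> \<sigma> / 6" and \<eta>: "0 \<le> \<eta>"
    and p: "p = (\<lambda>i. of_real (1 - 2 * \<epsilon>) * t i)"
    and g: "g holomorphic_on ball 0 r" "r > 1"
    and gB: "\<And>i z. i \<in> I \<Longrightarrow> cmod (z - p i) = \<epsilon> \<Longrightarrow>
               cmod (g z - blaschke c J a l z) \<le> \<eta> * \<epsilon> ^ (2 * k i - 1)"
  shows "cmod (contour_integral (circlepath 0 1) (weighted_defect c J a l I p k g))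
     \<le> card I * (4 ^ sum l J / (\<sigma> / 2) ^ (2 * sum k I) * (2 * pi)) * \<eta>"
proof -
  define H where "H = weighted_defect c J a l I p k g"
  define A where "A = 4 ^ sum l J / (\<sigma> / 2) ^ (2 * sum k I)"
  have A0: "A \<ge> 0" using sep by (simp add: A_def)
  have np: "cmod (p j) = 1 - 2 * \<epsilon>" if "j \<in> I" for j
    unfolding p norm_mult t [OF that] norm_of_real using \<epsilon> sep by simp
  then have p1: "cmod (p j) < 1" if "j \<in> I" for j using that \<epsilon> by simp
  have far: "\<epsilon> < cmod (p i - p j)" if "i \<in> I" "j \<in> I" "j \<noteq> i" for i j
  proof -
    have "p i - p j = of_real (1 - 2 * \<epsilon>) * (t i - t j)" by (simp add: p algebra_simps)
    then have "cmod (p i - p j) = (1 - 2 * \<epsilon>) * cmod (t i - t j)"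
      using \<epsilon> sep by (simp only: norm_mult norm_of_real)
    also have "\<dots> \<ge> (1 - 2 * \<epsilon>) * \<sigma>"
      using \<epsilon> sep that by (intro mult_left_mono) auto
    finally have 1: "cmod (p i - p j) \<ge> (1 - 2 * \<epsilon>) * \<sigma>" .
    have "\<epsilon> * \<sigma> \<le> \<epsilon>" using \<epsilon> sep by (simp add: mult_left_le)
    with 1 have "cmod (p i - p j) \<ge> \<sigma> - 2 * \<epsilon>" by (simp only: left_diff_distrib)
    then show ?thesis using \<epsilon> by linarith
  qed
  define S0 where "S0 = ball 0 r \<inter> {z. recip_prod I p k z \<noteq> 0}"
  have "open S0"
    unfolding S0_def
    by (intro open_Int open_ball open_Collect_neq continuous_on_const
        holomorphic_on_imp_continuous_on [OF recip_prod_holomorphic])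
  moreover have "cball 0 1 \<subseteq> S0"
    using recip_prod_nonzero [OF fin(1) p1] g(2) by (auto simp: S0_def)
  ultimately obtain r' where r': "r' > 1" "ball 0 r' \<subseteq> S0"
    by (rule open_superset_disc_contains_ball)
  have holoH: "H holomorphic_on (ball 0 r' - p ` I)"
    unfolding H_def weighted_defect_def
    using r'(2) zero_prod_eq_0_iff [OF fin(1), of p k]
    by (intro holomorphic_intros holomorphic_on_subset [OF g(1)]) (auto simp: S0_def)
  have "contour_integral (circlepath 0 1) H
      = 2 * pi * \<i> * (\<Sum>q\<in>p ` I. winding_number (circlepath 0 1) q * residue H q)"
  proof (rule Residue_theorem [OF _ _ _ holoH])
    show "path_image (circlepath 0 1) \<subseteq> ball 0 r' - p ` I"
      using r'(1) p1 by (fastforce simp: subset_iff)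
    show "\<forall>z. z \<notin> ball 0 r' \<longrightarrow> winding_number (circlepath 0 1) z = 0"
      using r'(1) by (intro allI impI winding_number_zero_outside [of _ "ball 0 r'"]) auto
  qed (use fin in auto)
  also have "\<dots> = (\<Sum>q\<in>p ` I. 2 * pi * \<i> * residue H q)"
    unfolding sum_distrib_left
  proof (rule sum.cong [OF refl])
    fix q assume "q \<in> p ` I"
    then have "winding_number (circlepath 0 1) q = 1"
      using p1 by (intro winding_number_circlepath) auto
    then show "2 * pi * \<i> * (winding_number (circlepath 0 1) q * residue H q) = 2 * pi * \<i> * residue H q"
      by simp
  qed
  also have "cmod \<dots> \<le> (\<Sum>q\<in>p ` I. A * (2 * pi) * \<eta>)"
  proof (rule sum_norm_le)
    fix q assume "q \<in> p ` I"
    then obtain i where i: "i \<in> I" "q = p i" by auto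
    have "(H has_contour_integral 2 * pi * \<i> * residue H q) (circlepath q \<epsilon>)"
    proof (rule base_residue)
      show "open (ball 0 r' - (p ` I - {q}))"
        using fin by (intro open_Diff finite_imp_closed) auto
      have "norm (p i) + \<epsilon> < r'" using np [OF i(1)] \<epsilon> r' by simp
      then have "cball q \<epsilon> \<subseteq> ball 0 r'"
        using i by (auto simp: dist_norm) (smt (verit) norm_triangle_sub norm_minus_commute)
      moreover have "p j \<notin> cball q \<epsilon>" if "j \<in> I" "p j \<noteq> q" for j
      proof -
        have "j \<noteq> i" using that i by auto
        then show ?thesis using far [of i j] that i by (auto simp: dist_norm)
      qed
      ultimately show cb: "cball q \<epsilon> \<subseteq> ball 0 r' - (p ` I - {q})" by blast
      then show "q \<in> ball 0 r' - (p ` I - {q})" using \<epsilon> by (auto simp: subset_iff)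
      show "H holomorphic_on (ball 0 r' - (p ` I - {q}) - {q})"
        using holoH by (rule holomorphic_on_subset) auto
    qed (use \<epsilon> in auto)
    then have "cmod (2 * pi * \<i> * residue H q) \<le> A * \<eta> / \<epsilon> * (2 * pi * \<epsilon>)"
    proof (rule has_contour_integral_bound_circlepath)
      fix z assume z: "cmod (z - q) = \<epsilon>"
      show "cmod (H z) \<le> A * \<eta> / \<epsilon>"
        unfolding H_def A_def
        by (rule weighted_defect_small_circle_bound [OF fin i(1) a t k c sep \<epsilon> p])
          (use i z gB in auto)
    qed (use A0 \<epsilon> \<eta> in auto)
    then show "cmod (2 * pi * \<i> * residue H q) \<le> A * (2 * pi) * \<eta>"
      using \<epsilon> by (simp add: mult_ac)
  qed
  also have "\<dots> = card (p ` I) * (A * (2 * pi) * \<eta>)" by simp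
  also have "\<dots> \<le> card I * (A * (2 * pi) * \<eta>)"
    using card_image_le [OF fin(1), of p] A0 \<eta> by (intro mult_right_mono) auto
  finally show ?thesis by (simp add: H_def A_def mult_ac)
qed

text \<open>
  Every point \<open>z\<close> of the circle satisfies \<open>1 - |z| \<ge> \<epsilon>\<close> and \<open>|z - t| \<le> 3 \<epsilon>\<close>, so all these circles lie in a single Stolz
  region, for which the aperture \<open>4\<close> suffices.
\<close>

lemma nontangential_contact_on_small_circles:
  assumes con: "nontangential_contact f b t m" and t: "cmod t = 1" and n: "n \<le> m" and \<eta>: "\<eta> > 0"
  shows "\<forall>\<^sub>F \<epsilon> in at_right 0. \<forall>z. cmod (z - of_real (1 - 2 * \<epsilon>) * t) = \<epsilon> \<longrightarrow>
           cmod (f z - b z) \<le> \<eta> * \<epsilon> ^ n"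
proof -
  have "((\<lambda>z. (f z - b z) / (z - t) ^ m) \<longlongrightarrow> 0) (at t within stolz_region t 4)"
    using con by (simp add: nontangential_contact_def)
  from tendstoD [OF this, of "\<eta> / 3 ^ m"] \<eta>
  have "\<forall>\<^sub>F z in at t within stolz_region t 4. cmod ((f z - b z) / (z - t) ^ m) < \<eta> / 3 ^ m"
    by simp
  then obtain d where d: "d > 0"
    and lt: "\<And>z. z \<in> stolz_region t 4 \<Longrightarrow> z \<noteq> t \<Longrightarrow> dist z t < d \<Longrightarrow>
        cmod ((f z - b z) / (z - t) ^ m) < \<eta> / 3 ^ m"
    unfolding eventually_at by blast
  have ev: "\<forall>\<^sub>F \<epsilon> in at_right 0. 0 < \<epsilon> \<and> \<epsilon> < min (1/2) (d / 3)"
    using d eventually_at_right_real [of 0 "min (1/2) (d / 3)"] by simp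
  then show ?thesis
  proof (rule eventually_mono, intro allI impI)
    fix \<epsilon> :: real and z
    assume e: "0 < \<epsilon> \<and> \<epsilon> < min (1/2) (d / 3)" and z: "cmod (z - of_real (1 - 2 * \<epsilon>) * t) = \<epsilon>"
    have "cmod (of_real (1 - 2 * \<epsilon>) * t) = 1 - 2 * \<epsilon>"
      unfolding norm_mult t norm_of_real using e by simp
    then have z1: "cmod z \<le> 1 - \<epsilon>"
      using norm_triangle_ineq [of "z - of_real (1 - 2 * \<epsilon>) * t" "of_real (1 - 2 * \<epsilon>) * t"] z by simp
    have eq: "z - t = (z - of_real (1 - 2 * \<epsilon>) * t) - of_real (2 * \<epsilon>) * t"
      by (simp add: algebra_simps)
    have "cmod (of_real (2 * \<epsilon>) * t) = 2 * \<epsilon>"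
      unfolding norm_mult t norm_of_real using e by simp
    then have z3: "cmod (z - t) \<le> 3 * \<epsilon>"
      using norm_triangle_ineq4 [of "z - of_real (1 - 2 * \<epsilon>) * t" "of_real (2 * \<epsilon>) * t"] z
      unfolding eq [symmetric] by simp
    have zt: "z \<noteq> t" using z1 t e by auto
    have "z \<in> stolz_region t 4" using z1 z3 e by (auto simp: stolz_region_def)
    from lt [OF this zt] z3 e have "cmod ((f z - b z) / (z - t) ^ m) < \<eta> / 3 ^ m"
      by (simp add: dist_norm)
    then have "cmod (f z - b z) \<le> \<eta> / 3 ^ m * cmod (z - t) ^ m"
      using zt by (simp add: norm_divide norm_power field_simps)
    also have "\<dots> \<le> \<eta> / 3 ^ m * (3 * \<epsilon>) ^ m"
      using z3 \<eta> by (intro mult_left_mono power_mono) auto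
    also have "\<dots> = \<eta> * \<epsilon> ^ m" by (simp add: power_mult_distrib)
    also have "\<dots> \<le> \<eta> * \<epsilon> ^ n"
      using e \<eta> n by (intro mult_left_mono power_decreasing) auto
    finally show "cmod (f z - b z) \<le> \<eta> * \<epsilon> ^ n" .
  qed
qed

section \<open>Uniqueness\<close>

lemma finite_points_separated:
  fixes t :: "'i \<Rightarrow> complex"
  assumes "finite I" "inj_on t I"
  obtains \<sigma> where "0 < \<sigma>" "\<sigma> \<le> 1"
    "\<And>i j. i \<in> I \<Longrightarrow> j \<in> I \<Longrightarrow> i \<noteq> j \<Longrightarrow> \<sigma> \<le> cmod (t i - t j)"
proof -
  \<comment> \<open>The element \<open>1\<close> keeps the set nonempty and its minimum at most one.\<close>
  define D where "D = insert 1 ((\<lambda>(i, j). cmod (t i - t j)) ` {(i, j) \<in> I \<times> I. i \<noteq> j})"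
  have fin: "finite D"
    unfolding D_def using assms(1)
    by (intro finite.insertI finite_imageI) (auto intro: finite_subset [of _ "I \<times> I"])
  have pos: "\<And>x. x \<in> D \<Longrightarrow> 0 < x"
    using assms(2) by (auto simp: D_def inj_on_def)
  show ?thesis
  proof (rule that [of "Min D"])
    show "0 < Min D" using fin pos by (subst Min_gr_iff) (auto simp: D_def)
    show "Min D \<le> 1" using fin by (intro Min_le) (auto simp: D_def)
    fix i j assume "i \<in> I" "j \<in> I" "i \<noteq> j"
    then show "Min D \<le> cmod (t i - t j)" using fin by (intro Min_le) (auto simp: D_def)
  qed
qed

text \<open>
  Fix \<open>w\<close>. The constant \<open>C\<close> below depends on \<open>w\<close>, the Blaschke product and the points \<open>t\<^sub>i\<close>, but not on the poles. For given
  \<open>\<eta>\<close> the radius \<open>\<epsilon>\<close> is chosen by the contact condition on \<open>f\<close>, and then \<open>\<rho>\<close> so close to one that the dilation \<open>f(\<rho> z)\<close>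
  is still within \<open>2 \<eta> \<epsilon> ^ (2 k\<^sub>i - 1)\<close> of \<open>b\<close> on the small circles. Dilations are holomorphic beyond the closed disc, which
  the residue argument requires.
\<close>

lemma schur_eq_blaschke_of_contact:
  assumes fin: "finite I" "finite J"
    and a: "\<And>j. j \<in> J \<Longrightarrow> cmod (a j) < 1" and t: "\<And>i. i \<in> I \<Longrightarrow> cmod (t i) = 1"
    and inj: "inj_on t I"
    and k: "\<And>i. i \<in> I \<Longrightarrow> k i > 0" and c: "cmod c = 1" and deg: "sum l J < sum k I"
    and f: "f \<in> schur_class"
    and con: "\<And>i. i \<in> I \<Longrightarrow> nontangential_contact f (blaschke c J a l) (t i) (m i)"
    and m: "\<And>i. i \<in> I \<Longrightarrow> 2 * k i - 1 \<le> m i"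
    and w: "cmod w < 1"
  shows "f w = blaschke c J a l w"
proof -
  define B where "B = blaschke c J a l"
  have fh: "f holomorphic_on ball 0 1" and fb: "\<And>z. cmod z < 1 \<Longrightarrow> cmod (f z) \<le> 1"
    using f by (auto simp: schur_class_def)
  have fc: "continuous_on (ball 0 1) f" using fh by (rule holomorphic_on_imp_continuous_on)
  obtain \<sigma> where \<sigma>: "0 < \<sigma>" "\<sigma> \<le> 1"
    "\<And>i j. i \<in> I \<Longrightarrow> j \<in> I \<Longrightarrow> i \<noteq> j \<Longrightarrow> \<sigma> \<le> cmod (t i - t j)"
    using finite_points_separated [OF fin(1) inj] by blast
  obtain \<delta> where \<delta>: "\<delta> > 0" "\<And>z. cmod z = 1 \<Longrightarrow> \<delta> \<le> (cmod (zero_prod J a l z))\<^sup>2"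
    using zero_prod_bounded_below_on_circle [where a = a and l = l, OF fin(2) a] by blast
  define C where "C = 4 ^ sum k I / (\<delta> * (1 - cmod w)) *
      (card I * (4 ^ sum l J / (\<sigma> / 2) ^ (2 * sum k I) * (2 * pi)))"
  have C0: "C \<ge> 0" using \<delta> \<sigma> w by (simp add: C_def)
  have main: "(cmod (f w - B w))\<^sup>2 \<le> C * (2 * \<eta>)" if \<eta>: "\<eta> > 0" for \<eta>
  proof -
    have "\<forall>\<^sub>F \<epsilon> in at_right 0. \<forall>i\<in>I. \<forall>z. cmod (z - of_real (1 - 2 * \<epsilon>) * t i) = \<epsilon> \<longrightarrow>
        cmod (f z - B z) \<le> \<eta> * \<epsilon> ^ (2 * k i - 1)"
      using con t m \<eta> unfolding B_def
      by (intro eventually_ball_finite fin(1) ballI nontangential_contact_on_small_circles) auto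
    moreover have "\<forall>\<^sub>F \<epsilon> in at_right 0. 0 < \<epsilon> \<and> \<epsilon> < \<sigma> / 6"
      using \<sigma> eventually_at_right_real [of 0 "\<sigma> / 6"] by simp
    ultimately have "\<forall>\<^sub>F \<epsilon> in at_right 0. (\<forall>i\<in>I. \<forall>z. cmod (z - of_real (1 - 2 * \<epsilon>) * t i) = \<epsilon> \<longrightarrow>
        cmod (f z - B z) \<le> \<eta> * \<epsilon> ^ (2 * k i - 1)) \<and> 0 < \<epsilon> \<and> \<epsilon> < \<sigma> / 6"
      by (rule eventually_conj)
    then obtain \<epsilon> where \<epsilon>: "0 < \<epsilon>" "\<epsilon> < \<sigma> / 6"
      and fB: "\<And>i z. i \<in> I \<Longrightarrow> cmod (z - of_real (1 - 2 * \<epsilon>) * t i) = \<epsilon> \<Longrightarrow>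
        cmod (f z - B z) \<le> \<eta> * \<epsilon> ^ (2 * k i - 1)"
      using eventually_happens' [OF trivial_limit_at_right_real] by blast
    define p where "p = (\<lambda>i. of_real (1 - 2 * \<epsilon>) * t i)"
    have np: "cmod (p i) = 1 - 2 * \<epsilon>" if "i \<in> I" for i
      unfolding p_def norm_mult t [OF that] norm_of_real using \<epsilon> \<sigma> by simp
    \<comment> \<open>As \<open>\<epsilon> < 1\<close>, this tolerance is below \<open>\<eta> \<epsilon> ^ (2 k\<^sub>i - 1)\<close> for all \<open>i\<close> at once.\<close>
    define \<mu> where "\<mu> = \<eta> * \<epsilon> ^ (2 * sum k I)"
    have \<mu>: "\<mu> > 0" using \<eta> \<epsilon> by (simp add: \<mu>_def)
    have "uniformly_continuous_on (cball 0 (1 - \<epsilon>)) f"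
      using \<epsilon> by (intro compact_uniformly_continuous continuous_on_subset [OF fc]) auto
    then obtain d where d: "d > 0"
      and uc: "\<And>y z. y \<in> cball 0 (1 - \<epsilon>) \<Longrightarrow> z \<in> cball 0 (1 - \<epsilon>) \<Longrightarrow> dist z y < d \<Longrightarrow> dist (f z) (f y) < \<mu>"
      unfolding uniformly_continuous_on_def using \<mu> by metis
    have step: "(cmod (f (of_real \<rho> * w) - B w))\<^sup>2 \<le> C * (2 * \<eta>)"
      if \<rho>: "\<rho> \<in> {max (1/2) (1 - d)<..<1}" for \<rho>
    proof -
      define g where "g = (\<lambda>z. f (of_real \<rho> * z))"
      have \<rho>': "0 < \<rho>" "\<rho> < 1" "1 - \<rho> < d" using \<rho> by auto
      have gh: "g holomorphic_on ball 0 (1 / \<rho>)"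
      proof -
        have "f \<circ> (\<lambda>z. of_real \<rho> * z) holomorphic_on ball 0 (1 / \<rho>)"
          using \<rho>' by (intro holomorphic_on_compose_gen [OF _ fh] holomorphic_intros)
            (auto simp: norm_mult field_simps)
        then show ?thesis by (simp add: g_def o_def)
      qed
      have r1: "1 / \<rho> > 1" using \<rho>' by simp
      have g1: "cmod (g z) \<le> 1" if "cmod z = 1" for z
        unfolding g_def using that \<rho>' by (intro fb) (simp add: norm_mult)
      have gB: "cmod (g z - B z) \<le> 2 * \<eta> * \<epsilon> ^ (2 * k i - 1)"
        if i: "i \<in> I" and z: "cmod (z - p i) = \<epsilon>" for i z
      proof -
        have z1: "cmod z \<le> 1 - \<epsilon>"
          using norm_triangle_ineq [of "z - p i" "p i"] z np [OF i] by simp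
        have "cmod (of_real \<rho> * z) \<le> 1 * cmod z"
          using \<rho>' unfolding norm_mult by (intro mult_right_mono) auto
        then have z2: "cmod (of_real \<rho> * z) \<le> 1 - \<epsilon>" using z1 by simp
        have "of_real \<rho> * z - z = - (of_real (1 - \<rho>) * z)" by (simp add: algebra_simps)
        then have "dist (of_real \<rho> * z) z = (1 - \<rho>) * cmod z"
          unfolding dist_norm using \<rho>' by (simp only: norm_minus_cancel norm_mult norm_of_real)
        also have "\<dots> \<le> (1 - \<rho>) * 1" using \<rho>' z1 \<epsilon> by (intro mult_left_mono) auto
        finally have "dist (of_real \<rho> * z) z < d" using \<rho>' by simp
        then have "cmod (g z - f z) \<le> \<mu>"
          using uc [of z "of_real \<rho> * z"] z1 z2 by (simp add: g_def dist_norm less_imp_le)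
        also have "k i \<le> sum k I" using i fin by (simp add: member_le_sum)
        then have "\<mu> \<le> \<eta> * \<epsilon> ^ (2 * k i - 1)"
          unfolding \<mu>_def using \<eta> \<epsilon> \<sigma> by (intro mult_left_mono power_decreasing) auto
        finally have "cmod (g z - f z) \<le> \<eta> * \<epsilon> ^ (2 * k i - 1)" .
        moreover have "cmod (f z - B z) \<le> \<eta> * \<epsilon> ^ (2 * k i - 1)"
          using fB [OF i] z by (simp add: p_def)
        ultimately show ?thesis
          using norm_triangle_ineq [of "g z - f z" "f z - B z"] by simp
      qed
      have "(cmod (g w - B w))\<^sup>2 \<le> 4 ^ sum k I / (\<delta> * (1 - cmod w)) *
          cmod (contour_integral (circlepath 0 1) (weighted_defect c J a l I p k g))"
        unfolding B_def
        by (rule interior_bound_by_weighted_defect [OF fin a _ c deg \<delta> gh r1 g1 w])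
          (use np \<epsilon> in auto)
      also have "\<dots> \<le> 4 ^ sum k I / (\<delta> * (1 - cmod w)) *
          (card I * (4 ^ sum l J / (\<sigma> / 2) ^ (2 * sum k I) * (2 * pi)) * (2 * \<eta>))"
        using \<epsilon> \<eta> \<delta> w gB unfolding B_def
        by (intro mult_left_mono weighted_defect_integral_bound
              [OF fin a t k c \<sigma> \<epsilon>(1) _ _ p_def gh r1]) auto
      finally show ?thesis by (simp add: C_def g_def mult_ac)
    qed
    have "\<forall>\<^sub>F \<rho> in at_left 1. (cmod (f (of_real \<rho> * w) - B w))\<^sup>2 \<le> C * (2 * \<eta>)"
      using d step by (intro eventually_mono [OF eventually_at_left_real [of "max (1/2) (1 - d)" 1]]) auto
    moreover have "((\<lambda>\<rho>. (cmod (f (of_real \<rho> * w) - B w))\<^sup>2) \<longlongrightarrow> (cmod (f (of_real 1 * w) - B w))\<^sup>2) (at_left 1)"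
    proof -
      have "isCont f (of_real 1 * w)"
        using fc w by (simp add: continuous_on_eq_continuous_at)
      then have "((\<lambda>\<rho>. f (of_real \<rho> * w)) \<longlongrightarrow> f (of_real 1 * w)) (at_left 1)"
        by (rule isCont_tendsto_compose) (intro tendsto_intros)
      then show ?thesis by (intro tendsto_intros)
    qed
    ultimately show ?thesis
      using tendsto_upperbound [OF _ _ trivial_limit_at_left_real] by fastforce
  qed
  have "(cmod (f w - B w))\<^sup>2 \<le> 0"
  proof (rule field_le_epsilon)
    fix e :: real assume e: "e > 0"
    define q where "q = e / (C + 1)"
    have "(cmod (f w - B w))\<^sup>2 \<le> C * (2 * (q / 2))"
      using e C0 by (intro main) (auto simp: q_def)
    also have "\<dots> = C * q" by simp
    also have "\<dots> \<le> (C + 1) * q" using e C0 by (intro mult_right_mono) (auto simp: q_def)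
    also have "\<dots> = e" using C0 by (simp add: q_def)
    finally show "(cmod (f w - B w))\<^sup>2 \<le> 0 + e" by simp
  qed
  then show ?thesis by (simp add: B_def)
qed

section \<open>A function vanishing at the contact points with dominating real part\<close>

text \<open>
  This is \<open>1 / \<Sum>\<^sub>i 1 / x\<^sub>i\<close> for \<open>x\<^sub>i = 1 - cnj t\<^sub>i z\<close>, the resistance of parallel resistors \<open>x\<^sub>i\<close>. Clearing denominators gives it the
  correct value \<open>0\<close> at the points \<open>t\<^sub>i\<close>, where the formula with reciprocals would divide by zero.
\<close>

definition parallel_sum :: "'i set \<Rightarrow> ('i \<Rightarrow> complex) \<Rightarrow> complex \<Rightarrow> complex" where
  "parallel_sum I t z =
     (\<Prod>i\<in>I. 1 - cnj (t i) * z) / (\<Sum>i\<in>I. \<Prod>j\<in>I - {i}. 1 - cnj (t j) * z)"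

lemma boundary_factor_eq_0_iff:
  assumes "cmod t = 1"
  shows "1 - cnj t * z = 0 \<longleftrightarrow> z = t"
proof -
  have "t * cnj t = 1" using assms by (simp flip: complex_norm_square)
  moreover have "t * (cnj t * z - 1) = (t * cnj t) * z - t" by (simp add: algebra_simps)
  ultimately have "z - t = t * (cnj t * z - 1)" by simp
  then show ?thesis using assms by auto
qed

text \<open>
  The factor \<open>v = 1 - cnj t z\<close> lies in the disc of radius one about one, which inversion maps to the half plane
  \<open>Re \<ge> 1 / 2\<close>.
\<close>

lemma Re_inverse_boundary_factor:
  assumes "cmod t = 1" "cmod z \<le> 1" "z \<noteq> t"
  shows "Re (1 / (1 - cnj t * z)) \<ge> 1 / 2"
proof -
  define v where "v = 1 - cnj t * z"
  have v0: "v \<noteq> 0" using boundary_factor_eq_0_iff [OF assms(1)] assms(3) by (simp add: v_def)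
  have "(cmod (1 - v))\<^sup>2 \<le> 1"
    using assms by (intro power_le_one) (auto simp: v_def norm_mult)
  then have "(cmod v)\<^sup>2 \<le> 2 * Re v"
    unfolding cmod_power2 by (simp add: power2_eq_square algebra_simps)
  moreover have "Re (1 / v) = Re v / (cmod v)\<^sup>2"
    by (simp add: Re_divide cmod_power2)
  moreover have "(cmod v)\<^sup>2 > 0" using v0 by simp
  ultimately have "Re (1 / v) \<ge> 1 / 2" by (simp only: pos_le_divide_eq)
  then show ?thesis by (simp add: v_def)
qed

lemma parallel_sum_eq_inverse:
  assumes "finite I" "\<And>i. i \<in> I \<Longrightarrow> cmod (t i) = 1" "z \<notin> t ` I"
  shows "(\<Sum>i\<in>I. \<Prod>j\<in>I - {i}. 1 - cnj (t j) * z)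
       = (\<Prod>i\<in>I. 1 - cnj (t i) * z) * (\<Sum>i\<in>I. 1 / (1 - cnj (t i) * z))"
  unfolding sum_distrib_left
proof (rule sum.cong [OF refl])
  fix i assume i: "i \<in> I"
  then have "1 - cnj (t i) * z \<noteq> 0" using boundary_factor_eq_0_iff assms(2,3) by blast
  then show "(\<Prod>j\<in>I - {i}. 1 - cnj (t j) * z) =
      (\<Prod>i\<in>I. 1 - cnj (t i) * z) * (1 / (1 - cnj (t i) * z))"
    by (simp add: prod.remove [OF assms(1) i])
qed

lemma Re_sum_inverse_boundary_factors:
  assumes "finite I" "I \<noteq> {}" "\<And>i. i \<in> I \<Longrightarrow> cmod (t i) = 1" "cmod z \<le> 1" "z \<notin> t ` I"
  shows "Re (\<Sum>i\<in>I. 1 / (1 - cnj (t i) * z)) \<ge> 1 / 2"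
proof -
  have "1 / 2 \<le> (\<Sum>i\<in>I. 1 / 2 :: real)"
    using assms(1,2) by (simp add: Suc_leI card_gt_0_iff)
  also have "\<dots> \<le> (\<Sum>i\<in>I. Re (1 / (1 - cnj (t i) * z)))"
    using assms(3-5) by (intro sum_mono Re_inverse_boundary_factor) auto
  finally show ?thesis by simp
qed

text \<open>
  At \<open>t\<^sub>i\<close> only the summand omitting the \<open>i\<close>-th factor survives, and it is nonzero because the points are distinct.
  Elsewhere the sum is a product of nonzero factors and a number with positive real part.
\<close>

lemma parallel_sum_denominator_nonzero:
  assumes "finite I" "I \<noteq> {}" "\<And>i. i \<in> I \<Longrightarrow> cmod (t i) = 1" "inj_on t I" "cmod z \<le> 1"
  shows "(\<Sum>i\<in>I. \<Prod>j\<in>I - {i}. 1 - cnj (t j) * z) \<noteq> 0"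
proof (cases "z \<in> t ` I")
  case True
  then obtain i where i: "i \<in> I" "z = t i" by auto
  have z0: "1 - cnj (t j) * z = 0 \<longleftrightarrow> j = i" if "j \<in> I" for j
    using boundary_factor_eq_0_iff [OF assms(3) [OF that], of z] i that assms(4)
    by (auto dest: inj_onD)
  have "(\<Sum>i'\<in>I - {i}. \<Prod>j\<in>I - {i'}. 1 - cnj (t j) * z) = 0"
    using z0 i assms(1) by (intro sum.neutral ballI) (auto simp: prod_zero_iff)
  then have "(\<Sum>i\<in>I. \<Prod>j\<in>I - {i}. 1 - cnj (t j) * z) = (\<Prod>j\<in>I - {i}. 1 - cnj (t j) * z)"
    by (simp add: sum.remove [OF assms(1) i(1)])
  then show ?thesis using z0 assms(1) by (simp add: prod_zero_iff)
next
  case False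
  have "(\<Prod>i\<in>I. 1 - cnj (t i) * z) \<noteq> 0"
    using boundary_factor_eq_0_iff assms(1,3) False by (auto simp: prod_zero_iff)
  moreover have "(\<Sum>i\<in>I. 1 / (1 - cnj (t i) * z)) \<noteq> 0"
    using Re_sum_inverse_boundary_factors [OF assms(1-3,5) False] by (auto simp del: Re_sum)
  ultimately show ?thesis
    by (simp add: parallel_sum_eq_inverse [OF assms(1,3) False])
qed

text \<open>
  If \<open>h = 1 / s\<close>, then \<open>Re h = |h|\<^sup>2 Re s\<close>, and \<open>Re s \<ge> 1 / 2\<close>.
\<close>

lemma Re_parallel_sum_ge:
  assumes "finite I" "I \<noteq> {}" "\<And>i. i \<in> I \<Longrightarrow> cmod (t i) = 1" "cmod z \<le> 1"
  shows "(cmod (parallel_sum I t z))\<^sup>2 \<le> 2 * Re (parallel_sum I t z)"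
proof (cases "z \<in> t ` I")
  case True
  then have "(\<Prod>i\<in>I. 1 - cnj (t i) * z) = 0"
    using boundary_factor_eq_0_iff assms(1,3) by (auto simp: prod_zero_iff)
  then show ?thesis by (simp add: parallel_sum_def)
next
  case False
  define s where "s = (\<Sum>i\<in>I. 1 / (1 - cnj (t i) * z))"
  have s: "Re s \<ge> 1 / 2"
    unfolding s_def using assms False by (intro Re_sum_inverse_boundary_factors)
  then have s0: "s \<noteq> 0" by auto
  have "(\<Prod>i\<in>I. 1 - cnj (t i) * z) \<noteq> 0"
    using boundary_factor_eq_0_iff assms(1,3) False by (auto simp: prod_zero_iff)
  then have h: "parallel_sum I t z = 1 / s"
    by (simp add: parallel_sum_def parallel_sum_eq_inverse [OF assms(1,3) False] s_def)
  have "Re (1 / s) = Re s / (cmod s)\<^sup>2" by (simp add: Re_divide cmod_power2)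
  then show ?thesis unfolding h using s s0 by (simp add: norm_divide power_divide field_simps)
qed

lemma norm_one_minus_scaled_le_1:
  assumes h: "(cmod h)\<^sup>2 \<le> 2 * Re h" and x: "0 \<le> x" "x \<le> 1"
  shows "cmod (1 - of_real x * h) \<le> 1"
proof -
  have "(cmod (1 - of_real x * h))\<^sup>2 = 1 - 2 * x * Re h + x * (x * (cmod h)\<^sup>2)"
    unfolding cmod_power2 by (simp add: power2_eq_square algebra_simps)
  also have "x * (x * (cmod h)\<^sup>2) \<le> x * (1 * (2 * Re h))"
    using h x by (intro mult_left_mono mult_mono) auto
  finally have "(cmod (1 - of_real x * h))\<^sup>2 \<le> 1" by simp
  then show ?thesis by (simp add: power2_le_imp_le [of _ 1])
qed

section \<open>Failure of uniqueness\<close>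

lemma tendsto_0_of_zero_order:
  fixes t :: complex
  assumes eq: "\<And>z. z \<in> S \<Longrightarrow> F z = (z - t) ^ n * G z"
    and G: "continuous_on (insert t S) G" and m: "m < n"
  shows "((\<lambda>z. F z / (z - t) ^ m) \<longlongrightarrow> 0) (at t within S)"
proof -
  have "(G \<longlongrightarrow> G t) (at t within S)"
    using G by (auto simp: continuous_on_def intro: tendsto_within_subset)
  moreover have "((\<lambda>z. (z - t) ^ (n - m)) \<longlongrightarrow> (t - t) ^ (n - m)) (at t within S)"
    by (intro tendsto_intros)
  ultimately have "((\<lambda>z. (z - t) ^ (n - m) * G z) \<longlongrightarrow> (t - t) ^ (n - m) * G t) (at t within S)"
    by (intro tendsto_mult)
  then have "((\<lambda>z. (z - t) ^ (n - m) * G z) \<longlongrightarrow> 0) (at t within S)" using m by (simp add: power_0_left)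
  moreover have "\<forall>\<^sub>F z in at t within S. (z - t) ^ (n - m) * G z = F z / (z - t) ^ m"
    unfolding eventually_at_filter
  proof (intro always_eventually allI impI)
    fix z assume z: "z \<noteq> t" "z \<in> S"
    have "(z - t) ^ n = (z - t) ^ m * (z - t) ^ (n - m)"
      using m by (simp flip: power_add)
    then show "(z - t) ^ (n - m) * G z = F z / (z - t) ^ m"
      using z by (simp add: eq)
  qed
  ultimately show ?thesis
    by (rule Lim_transform_eventually)
qed

text \<open>
  The perturbation \<open>E\<close> is \<open>\<epsilon> b h |T|\<^sup>2 / |N|\<^sup>2\<close> on the circle, rewritten through \<open>|T|\<^sup>2 = T U / z\<^sup>K\<close> and \<open>cnj N = D / z\<^sup>d\<close> so
  that it makes sense in the disc. There \<open>T\<close> and \<open>U\<close> each vanish to order \<open>k\<^sub>i\<close> at \<open>t\<^sub>i\<close>, and \<open>h\<close> adds a simple zero.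
\<close>

lemma schur_contact_not_unique:
  assumes fin: "finite I" "finite J" and I: "I \<noteq> {}"
    and a: "\<And>j. j \<in> J \<Longrightarrow> cmod (a j) < 1" and t: "\<And>i. i \<in> I \<Longrightarrow> cmod (t i) = 1"
    and inj: "inj_on t I" and c: "cmod c = 1" and deg: "sum k I \<le> sum l J"
    and m: "\<And>i. i \<in> I \<Longrightarrow> m i \<le> 2 * k i"
  obtains f where "f \<in> schur_class" "\<exists>z\<in>ball 0 1. f z \<noteq> blaschke c J a l z"
    "\<And>i. i \<in> I \<Longrightarrow> nontangential_contact f (blaschke c J a l) (t i) (m i)"
proof -
  define B where "B = blaschke c J a l"
  define N where "N = zero_prod J a l"
  define D where "D = recip_prod J a l"
  define T where "T = zero_prod I t k"
  define U where "U = recip_prod I t k"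
  define h where "h = parallel_sum I t"
  define d where "d = sum l J"
  define K where "K = sum k I"
  have D0: "D z \<noteq> 0" if "cmod z \<le> 1" for z
    unfolding D_def using recip_prod_nonzero [OF fin(2) a that] .
  have Q0: "(\<Sum>i\<in>I. \<Prod>j\<in>I - {i}. 1 - cnj (t j) * z) \<noteq> 0" if "cmod z \<le> 1" for z
    using parallel_sum_denominator_nonzero [OF fin(1) I t inj that] .
  obtain \<delta> where \<delta>: "\<delta> > 0" "\<And>z. cmod z = 1 \<Longrightarrow> \<delta> \<le> (cmod (N z))\<^sup>2"
    unfolding N_def using zero_prod_bounded_below_on_circle [where a = a and l = l, OF fin(2) a] by blast
  \<comment> \<open>Small enough for \<open>e |T|\<^sup>2 / |N|\<^sup>2 \<le> 1\<close> on the circle.\<close>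
  define e where "e = \<delta> / 4 ^ K"
  have e: "e > 0" using \<delta> by (simp add: e_def)
  define E where "E = (\<lambda>z. of_real e * c * T z * U z * z ^ (d - K) * h z / (D z)\<^sup>2)"
  define f where "f = (\<lambda>z. B z - E z)"
  have f_holo: "f holomorphic_on cball 0 1"
    unfolding f_def B_def blaschke_def E_def h_def parallel_sum_def T_def U_def D_def
    using D0 Q0 by (intro holomorphic_intros) (auto simp: D_def)
  have bdry: "cmod (f z) \<le> 1" if z: "cmod z = 1" for z
  proof -
    have N0: "N z \<noteq> 0" unfolding N_def using zero_prod_nonzero_on_circle [OF fin(2) a z] .
    have z0: "z \<noteq> 0" using z by auto
    have DN: "D z = z ^ d * cnj (N z)" and UT: "U z = z ^ K * cnj (T z)"
      using recip_prod_on_circle [OF z] by (simp_all add: D_def N_def U_def T_def d_def K_def)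
    define r where "r = (cmod (T z) / cmod (N z))\<^sup>2"
    have r_eq: "of_real r = (T z * cnj (T z)) / (N z * cnj (N z))"
      unfolding r_def power_divide of_real_divide complex_norm_square ..
    have pw: "z ^ K * z ^ (d - K) = z ^ d"
      using deg by (simp add: d_def K_def flip: power_add)
    have "E z = of_real e * c * T z * cnj (T z) * (z ^ K * z ^ (d - K)) * h z / (D z * (z ^ d * cnj (N z)))"
      unfolding E_def UT power2_eq_square by (subst (2) DN) (simp add: mult_ac)
    also have "\<dots> = B z * (of_real (e * r) * h z)"
      unfolding pw of_real_mult r_eq B_def blaschke_def N_def [symmetric] D_def [symmetric]
      using N0 z0 D0 [of z] z by (simp add: field_simps)
    finally have "f z = B z * (1 - of_real (e * r) * h z)"
      by (simp add: f_def algebra_simps)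
    then have "cmod (f z) = cmod (1 - of_real (e * r) * h z)"
      unfolding B_def using blaschke_unimodular_on_circle [OF fin(2) a c z] by (simp add: norm_mult)
    also have "\<dots> \<le> 1"
    proof (rule norm_one_minus_scaled_le_1)
      show "(cmod (h z))\<^sup>2 \<le> 2 * Re (h z)"
        unfolding h_def using z by (intro Re_parallel_sum_ge fin I t) auto
      show "0 \<le> e * r" using e by (simp add: r_def)
      have "(cmod (T z))\<^sup>2 \<le> (2 ^ K)\<^sup>2"
        unfolding T_def K_def using zero_prod_le [of I t z k] t z by (intro power_mono) auto
      also have "\<dots> = 4 ^ K" by (simp add: power_even_eq [symmetric] power_mult)
      finally have "r \<le> 4 ^ K / \<delta>"
        unfolding r_def power_divide using \<delta> z by (intro frac_le) auto
      then show "e * r \<le> 1"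
        using \<delta> by (simp add: e_def field_simps)
    qed
    finally show ?thesis .
  qed
  have schur: "f \<in> schur_class"
    unfolding schur_class_def
  proof (intro CollectI conjI ballI)
    show "f holomorphic_on ball 0 1" using f_holo by (rule holomorphic_on_subset) auto
    fix z :: complex assume "z \<in> ball 0 1"
    then show "cmod (f z) \<le> 1"
      using bdry holomorphic_on_imp_continuous_on [OF f_holo]
      by - (rule maximum_modulus_frontier [of f "ball 0 1"],
          auto intro: holomorphic_on_subset [OF f_holo])
  qed
  have neq: "f (1/2) \<noteq> B (1/2)"
  proof -
    have half: "cmod (1/2 :: complex) = 1/2" by (simp add: norm_divide)
    have ne: "1/2 \<noteq> t i" if "i \<in> I" for i
    proof
      assume "1/2 = t i"
      with half have "cmod (t i) = 1/2" by metis
      then show False using t [OF that] by simp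
    qed
    then have "T (1/2) \<noteq> 0" unfolding T_def zero_prod_eq_0_iff [OF fin(1)] by blast
    moreover have fac: "1 - cnj (t i) * (1/2) \<noteq> 0" if "i \<in> I" for i
      using boundary_factor_eq_0_iff [OF t [OF that], of "1/2"] ne [OF that] by blast
    then have "U (1/2) \<noteq> 0" unfolding U_def recip_prod_def
      using fin(1) by (subst prod_zero_iff) (auto simp del: mult_cancel_left1)
    moreover have "h (1/2) \<noteq> 0"
      unfolding h_def parallel_sum_def divide_eq_0_iff
      using Q0 [of "1/2"] half fac fin(1) by (simp add: prod_zero_iff del: times_divide_eq_right)
    moreover have "c \<noteq> 0" using c by auto
    ultimately have "E (1/2) \<noteq> 0"
      using D0 [of "1/2"] half e by (simp add: E_def)
    then show ?thesis by (simp add: f_def)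
  qed
  have contact: "nontangential_contact f B (t i) (m i)" if i: "i \<in> I" for i
    unfolding nontangential_contact_def
  proof (intro allI impI)
    fix M :: real assume "M > 1"
    \<comment> \<open>\<open>G\<close> is what remains of \<open>- E\<close> after the zero of order \<open>2 k\<^sub>i + 1\<close> at \<open>t\<^sub>i\<close> has been divided out.\<close>
    define s where "s = - cnj (t i)"
    have "t i * cnj (t i) = 1" using t [OF i] by (simp flip: complex_norm_square)
    then have fac: "1 - cnj (t i) * z = s * (z - t i)" for z
      by (simp add: s_def algebra_simps)
    define G where "G = (\<lambda>z. - (of_real e * c * zero_prod (I - {i}) t k z
        * (s ^ k i * recip_prod (I - {i}) t k z) * z ^ (d - K)
        * (s * (\<Prod>j\<in>I - {i}. 1 - cnj (t j) * z) / (\<Sum>i\<in>I. \<Prod>j\<in>I - {i}. 1 - cnj (t j) * z))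
        / (D z)\<^sup>2))"
    have "((\<lambda>z. (f z - B z) / (z - t i) ^ m i) \<longlongrightarrow> 0) (at (t i) within cball 0 1)"
    proof (rule tendsto_0_of_zero_order)
      show "m i < 2 * k i + 1" using m [OF i] by simp
      have "G holomorphic_on cball 0 1"
        unfolding G_def D_def using D0 Q0 by (intro holomorphic_intros) (auto simp: D_def)
      moreover have "insert (t i) (cball 0 1) = cball 0 1" using t [OF i] by auto
      ultimately show "continuous_on (insert (t i) (cball 0 1)) G"
        using holomorphic_on_imp_continuous_on by simp
      fix z assume "z \<in> cball (0::complex) 1"
      have T_eq: "T z = (z - t i) ^ k i * zero_prod (I - {i}) t k z"
        unfolding T_def zero_prod_def by (rule prod.remove [OF fin(1) i])
      have U_eq: "U z = (s * (z - t i)) ^ k i * recip_prod (I - {i}) t k z"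
        unfolding U_def recip_prod_def fac [symmetric] by (rule prod.remove [OF fin(1) i])
      have h_eq: "h z = s * (z - t i) * (\<Prod>j\<in>I - {i}. 1 - cnj (t j) * z)
          / (\<Sum>i\<in>I. \<Prod>j\<in>I - {i}. 1 - cnj (t j) * z)"
        unfolding h_def parallel_sum_def fac [symmetric] by (subst prod.remove [OF fin(1) i]) simp
      have power_eq: "(z - t i) ^ (2 * k i + 1) = (z - t i) ^ k i * (z - t i) ^ k i * (z - t i)"
        by (simp add: mult_2 power_add)
      show "f z - B z = (z - t i) ^ (2 * k i + 1) * G z"
        unfolding f_def E_def T_eq U_eq h_eq G_def
        unfolding power_eq by (simp add: power_mult_distrib mult_ac)
    qed
    then show "((\<lambda>z. (f z - B z) / (z - t i) ^ m i) \<longlongrightarrow> 0) (at (t i) within stolz_region (t i) M)"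
      by (rule tendsto_within_subset) (auto simp: stolz_region_def)
  qed
  show ?thesis
  proof (rule that [OF schur])
    show "\<exists>z\<in>ball 0 1. f z \<noteq> blaschke c J a l z"
      using neq by (intro bexI [of _ "1/2"]) (auto simp: B_def norm_divide)
  qed (use contact in \<open>simp add: B_def\<close>)
qed

section \<open>The dichotomy\<close>

lemma nontangential_contact_cong:
  assumes "\<And>z. z \<in> ball 0 1 \<Longrightarrow> b z = b' z"
  shows "nontangential_contact f b t m \<longleftrightarrow> nontangential_contact f b' t m"
proof -
  have "((\<lambda>z. (f z - b z) / (z - t) ^ m) \<longlongrightarrow> 0) (at t within stolz_region t M)
    \<longleftrightarrow> ((\<lambda>z. (f z - b' z) / (z - t) ^ m) \<longlongrightarrow> 0) (at t within stolz_region t M)" for M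
    using assms by (intro Lim_cong_within) (auto simp: stolz_region_def)
  then show ?thesis by (simp add: nontangential_contact_def)
qed

theorem theorem1p3:
  fixes b :: "complex \<Rightarrow> complex" and d n :: nat
    and t :: "nat \<Rightarrow> complex" and m :: "nat \<Rightarrow> nat"
  assumes "finite_blaschke_product d b"
    and "n \<ge> 1"
    and "\<forall>i\<in>{1..n}. t i \<in> sphere 0 1"
    and "inj_on t {1..n}"
    and "\<forall>i\<in>{1..n}. m i > 0"
  shows "((\<Sum>i=1..n. \<lfloor>(real (m i) + 1) / 2\<rfloor>) > int d \<longrightarrow>
           (\<forall>f\<in>schur_class. (\<forall>i\<in>{1..n}. nontangential_contact f b (t i) (m i)) \<longrightarrow>
              (\<forall>z\<in>ball 0 1. f z = b z)))
       \<and> ((\<Sum>i=1..n. \<lfloor>(real (m i) + 1) / 2\<rfloor>) \<le> int d \<longrightarrow>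
           (\<exists>f\<in>schur_class. (\<exists>z\<in>ball 0 1. f z \<noteq> b z) \<and>
              (\<forall>i\<in>{1..n}. nontangential_contact f b (t i) (m i))))"
proof -
  obtain c a where c: "cmod c = 1" and a_ball: "\<forall>j\<in>{1..d}. a j \<in> ball 0 1"
    and b: "\<forall>z\<in>ball 0 1. b z = c * (\<Prod>j=1..d. (z - a j) / (1 - cnj (a j) * z))"
    using assms(1) unfolding finite_blaschke_product_def by blast
  have a: "\<And>j. j \<in> {1..d} \<Longrightarrow> cmod (a j) < 1" using a_ball by auto
  define l where "l = (\<lambda>j::nat. 1::nat)"
  define B where "B = blaschke c {1..d} a l"
  have bB: "b z = B z" if "z \<in> ball 0 1" for z
    using b that by (simp add: B_def blaschke_def zero_prod_def recip_prod_def l_def prod_dividef)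
  have con: "nontangential_contact f b u q \<longleftrightarrow> nontangential_contact f B u q" for f u q
    using bB by (rule nontangential_contact_cong)
  define k where "k = (\<lambda>i. (m i + 1) div 2)"
  have "\<lfloor>(real (m i) + 1) / 2\<rfloor> = int (k i)" for i
    using floor_divide_of_nat_eq [of "m i + 1" 2, where ?'a = real] by (simp add: k_def add_ac)
  then have K: "(\<Sum>i=1..n. \<lfloor>(real (m i) + 1) / 2\<rfloor>) = int (sum k {1..n})" by simp
  have d: "sum l {1..d} = d" by (simp add: l_def)
  have t: "\<And>i. i \<in> {1..n} \<Longrightarrow> cmod (t i) = 1" using assms(3) by auto
  show ?thesis
    unfolding K of_nat_less_iff of_nat_le_iff
  proof (intro conjI impI ballI)
    fix f :: "complex \<Rightarrow> complex" and z :: complex assume deg: "d < sum k {1..n}" and f: "f \<in> schur_class"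
      and *: "\<forall>i\<in>{1..n}. nontangential_contact f b (t i) (m i)" and z: "z \<in> ball 0 1"
    have "f z = B z"
      unfolding B_def
    proof (rule schur_eq_blaschke_of_contact [OF _ _ a t assms(4) _ c _ f])
      show "sum l {1..d} < sum k {1..n}" using deg d by simp
      show "k i > 0" if "i \<in> {1..n}" for i using assms(5) that by (force simp: k_def)
      show "nontangential_contact f (blaschke c {1..d} a l) (t i) (m i)" if "i \<in> {1..n}" for i
        using * that con by (simp add: B_def)
      show "2 * k i - 1 \<le> m i" if "i \<in> {1..n}" for i by (simp add: k_def)
    qed (use z in auto)
    then show "f z = b z" using bB [OF z] by simp
  next
    assume deg: "sum k {1..n} \<le> d"
    obtain f where "f \<in> schur_class" "\<exists>z\<in>ball 0 1. f z \<noteq> B z"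
      "\<And>i. i \<in> {1..n} \<Longrightarrow> nontangential_contact f B (t i) (m i)"
      unfolding B_def
    proof (rule schur_contact_not_unique [OF _ _ _ a t assms(4) c])
      show "sum k {1..n} \<le> sum l {1..d}" using deg d by simp
      show "m i \<le> 2 * k i" if "i \<in> {1..n}" for i by (simp add: k_def)
    qed (use assms(2) in auto)
    then show "\<exists>f\<in>schur_class. (\<exists>z\<in>ball 0 1. f z \<noteq> b z) \<and>
        (\<forall>i\<in>{1..n}. nontangential_contact f b (t i) (m i))"
      using bB con by auto
  qed
qed

end
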